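(* Let $P=\{p_{\alpha,\beta} : \alpha>0,\ \beta>0\}$ be the statistical manifold of two-parameter Pareto densities, with global coordinates $(\alpha,\beta)\in\mathbb R^+\times\mathbb R^+$ and Fisher--Rao metric \[ g=\frac{\beta^2}{\alpha^2}\,\mathrm d\alpha\otimes\mathrm d\alpha+\frac{1}{\beta^2}\,\mathrm d\beta\otimes\mathrm d\beta . \] Let $(H,h)$ be the Poincaré upper half-plane, $H=\{(x,y)\in\mathbb R^2: y>0\}$, $h=\dfrac{\mathrm dx\otimes\mathrm dx+\mathrm dy\otimes\mathrm dy}{y^2}$. Then the map $F:P\to H$, $F(p_{\alpha,\beta})=(\log\alpha,\,1/\beta)$, is a diffeomorphism and is an isometry between $(P,g)$ and $(H,h)$, i.e. $F^*h=g$.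
   Context: The Pareto density with parameters $\alpha,\beta>0$ is $p_{\alpha,\beta}(x)=p(x\,|\,\alpha,\beta)=\dfrac{\beta\alpha^\beta}{x^{\beta+1}}$ for $x\ge\alpha$ and $0$ otherwise. The set $P$ is given the smooth structure of $\mathbb R^+\times\mathbb R^+$ via $p_{\alpha,\beta}\leftrightarrow(\alpha,\beta)$, where $\mathbb R^+=(0,\infty)$. A diffeomorphism $F:(M,g)\to(N,h)$ of Riemannian manifolds is an isometry if $F^*h=g$. *)

theory Defs
  imports "HOL-Analysis.Analysis"
begin

text \<open>Smoothness on an open set. Iterated directional derivatives suffice since every
  directional derivative of the derivative is again required to be differentiable.\<close>

primrec times_differentiable_on ::
  "nat \<Rightarrow> ('a::euclidean_space \<Rightarrow> 'b::real_normed_vector) \<Rightarrow> 'a set \<Rightarrow> bool" where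
  "times_differentiable_on 0 f S \<longleftrightarrow> continuous_on S f"
| "times_differentiable_on (Suc n) f S \<longleftrightarrow>
     (\<forall>x\<in>S. f differentiable (at x)) \<and>
     (\<forall>v. times_differentiable_on n (\<lambda>x. frechet_derivative f (at x) v) S)"

definition smooth_on :: "('a::euclidean_space \<Rightarrow> 'b::real_normed_vector) \<Rightarrow> 'a set \<Rightarrow> bool" where
  "smooth_on f S \<longleftrightarrow> (\<forall>n. times_differentiable_on n f S)"

text \<open>A manifold with one global chart, together with a metric. Tangent vectors at a point are
  given by their components with respect to the coordinate vector fields of that chart, so
  \<open>metric M p u v\<close> is the value of the metric tensor at \<open>p\<close> on the vectors with components
  \<open>u\<close> and \<open>v\<close>.\<close>

record ('p, 'e) metric_manifold =
  points :: "'p set"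
  chart :: "'p \<Rightarrow> 'e"
  metric :: "'p \<Rightarrow> 'e \<Rightarrow> 'e \<Rightarrow> real"

definition riemannian_manifold :: "('p, 'e::euclidean_space) metric_manifold \<Rightarrow> bool" where
  "riemannian_manifold M \<longleftrightarrow>
     inj_on (chart M) (points M) \<and>
     open (chart M ` points M) \<and>
     (\<forall>p\<in>points M. bilinear (metric M p) \<and>
        (\<forall>u v. metric M p u v = metric M p v u) \<and>
        (\<forall>u. u \<noteq> 0 \<longrightarrow> metric M p u u > 0)) \<and>
     (\<forall>u v. smooth_on (\<lambda>c. metric M (inv_into (points M) (chart M) c) u v)
              (chart M ` points M))"

definition coord_rep ::
  "('p, 'e) metric_manifold \<Rightarrow> ('q, 'f) metric_manifold \<Rightarrow> ('p \<Rightarrow> 'q) \<Rightarrow> 'e \<Rightarrow> 'f" where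
  "coord_rep M N F = chart N \<circ> F \<circ> inv_into (points M) (chart M)"

definition smooth_map ::
  "('p, 'e::euclidean_space) metric_manifold \<Rightarrow> ('q, 'f::euclidean_space) metric_manifold
     \<Rightarrow> ('p \<Rightarrow> 'q) \<Rightarrow> bool" where
  "smooth_map M N F \<longleftrightarrow>
     F ` points M \<subseteq> points N \<and> smooth_on (coord_rep M N F) (chart M ` points M)"

definition diffeomorphism ::
  "('p, 'e::euclidean_space) metric_manifold \<Rightarrow> ('q, 'f::euclidean_space) metric_manifold
     \<Rightarrow> ('p \<Rightarrow> 'q) \<Rightarrow> bool" where
  "diffeomorphism M N F \<longleftrightarrow>
     bij_betw F (points M) (points N) \<and>
     smooth_map M N F \<and> smooth_map N M (inv_into (points M) F)"

definition differential ::
  "('p, 'e::euclidean_space) metric_manifold \<Rightarrow> ('q, 'f::euclidean_space) metric_manifold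
     \<Rightarrow> ('p \<Rightarrow> 'q) \<Rightarrow> 'p \<Rightarrow> 'e \<Rightarrow> 'f" where
  "differential M N F p = frechet_derivative (coord_rep M N F) (at (chart M p))"

definition pullback_metric ::
  "('p, 'e::euclidean_space) metric_manifold \<Rightarrow> ('q, 'f::euclidean_space) metric_manifold
     \<Rightarrow> ('p \<Rightarrow> 'q) \<Rightarrow> 'p \<Rightarrow> 'e \<Rightarrow> 'e \<Rightarrow> real" where
  "pullback_metric M N F p u v =
     metric N (F p) (differential M N F p u) (differential M N F p v)"

definition isometry ::
  "('p, 'e::euclidean_space) metric_manifold \<Rightarrow> ('q, 'f::euclidean_space) metric_manifold
     \<Rightarrow> ('p \<Rightarrow> 'q) \<Rightarrow> bool" where
  "isometry M N F \<longleftrightarrow>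
     riemannian_manifold M \<and> riemannian_manifold N \<and> diffeomorphism M N F \<and>
     (\<forall>p\<in>points M. \<forall>u v. pullback_metric M N F p u v = metric M p u v)"

text \<open>The Fisher--Rao metric of a family of densities on the real line: the expectation of the
  product of the directional derivatives of the log-likelihood. For the Pareto family the
  log-likelihood fails to be differentiable in the parameters only at the single point
  \<open>x = \<alpha>\<close>, which is a null set. For \<open>x < \<alpha>\<close> the integrand vanishes because the density does.\<close>

definition fisher_rao ::
  "('e::euclidean_space \<Rightarrow> real \<Rightarrow> real) \<Rightarrow> 'e \<Rightarrow> 'e \<Rightarrow> 'e \<Rightarrow> real" where
  "fisher_rao f t u v =
     (LINT x|lborel.
        frechet_derivative (\<lambda>s. ln (f s x)) (at t) u *
        frechet_derivative (\<lambda>s. ln (f s x)) (at t) v * f t x)"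

definition pareto_density :: "real \<Rightarrow> real \<Rightarrow> real \<Rightarrow> real" where
  "pareto_density \<alpha> \<beta> x = (if x \<ge> \<alpha> then \<beta> * \<alpha> powr \<beta> / x powr (\<beta> + 1) else 0)"

definition pareto_chart :: "(real \<Rightarrow> real) \<Rightarrow> real \<times> real" where
  "pareto_chart = inv_into ({0<..} \<times> {0<..}) (\<lambda>(\<alpha>, \<beta>). pareto_density \<alpha> \<beta>)"

definition pareto_manifold :: "(real \<Rightarrow> real, real \<times> real) metric_manifold" where
  "pareto_manifold =
     \<lparr>points = {pareto_density \<alpha> \<beta> | \<alpha> \<beta>. \<alpha> > 0 \<and> \<beta> > 0},
      chart = pareto_chart,
      metric = (\<lambda>p. fisher_rao (\<lambda>(\<alpha>, \<beta>). pareto_density \<alpha> \<beta>) (pareto_chart p))\<rparr>"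

definition half_plane :: "(real \<times> real, real \<times> real) metric_manifold" where
  "half_plane =
     \<lparr>points = {(x, y). y > 0},
      chart = (\<lambda>q. q),
      metric = (\<lambda>(x, y) u v. (fst u * fst v + snd u * snd v) / y\<^sup>2)\<rparr>"

text \<open>The parameters are determined by the density, so \<open>pareto_chart\<close> really inverts the
  parametrisation, and maps on the family may be prescribed in terms of the parameters.\<close>

lemma pareto_density_inj:
  "inj_on (\<lambda>(\<alpha>, \<beta>). pareto_density \<alpha> \<beta>) ({0<..} \<times> {0<..})"
proof (rule inj_onI, clarsimp)
  fix a b c d :: real
  assume pos: "a > 0" "b > 0" "c > 0" "d > 0" and eq: "pareto_density a b = pareto_density c d"
  have *: "pareto_density a b x > 0 \<longleftrightarrow> x \<ge> a" if "a > 0" "b > 0" for a b x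
    using that by (auto simp: pareto_density_def)
  have "a \<le> c" "c \<le> a"
    using *[OF pos(1,2)] *[OF pos(3,4)] eq by (metis order_refl)+
  then have ac: "a = c" by simp
  have "pareto_density a b a = b / a" if "a > 0" for a b
    using that by (simp add: pareto_density_def powr_add)
  then have "b / a = d / a"
    using eq pos ac by metis
  with ac pos show "a = c \<and> b = d" by simp
qed

lemma pareto_chart_density:
  "\<alpha> > 0 \<Longrightarrow> \<beta> > 0 \<Longrightarrow> pareto_chart (pareto_density \<alpha> \<beta>) = (\<alpha>, \<beta>)"
  using inv_into_f_f[OF pareto_density_inj, of "(\<alpha>, \<beta>)"] by (simp add: pareto_chart_def)

end

theory Submission
  imports Defs "HOL-Real_Asymp.Real_Asymp"
begin

text \<open>Write \<open>L = ln (x / \<alpha>)\<close>. On the support of the Pareto density the score in the direction \<open>u\<close> is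
  \<open>u\<^sub>1 \<beta> / \<alpha> + u\<^sub>2 (1 / \<beta> - L)\<close>, and \<open>L\<close> is exponentially distributed with rate \<open>\<beta>\<close>, so that its
  first two moments are \<open>1 / \<beta>\<close> and \<open>2 / \<beta>\<^sup>2\<close>; this gives the diagonal Fisher--Rao metric. In the
  coordinates, \<open>F\<close> is \<open>(\<alpha>, \<beta>) \<mapsto> (ln \<alpha>, 1 / \<beta>)\<close> with inverse \<open>(x, y) \<mapsto> (exp x, 1 / y)\<close> and
  differential \<open>u \<mapsto> (u\<^sub>1 / \<alpha>, - u\<^sub>2 / \<beta>\<^sup>2)\<close>, from which \<open>F\<^sup>* h = g\<close> is read off.\<close>

section \<open>Smooth functions\<close>

text \<open>Derivatives at a point of an open set depend only on the values inside it, so agreement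
  passes to every order. This lets coordinate expressions built with \<open>inv_into\<close>,
  controlled only on the image of a chart, be replaced by explicit formulas.\<close>

lemma times_differentiable_on_cong:
  assumes "open S" "\<And>x. x \<in> S \<Longrightarrow> f x = g x"
  shows "times_differentiable_on n f S \<longleftrightarrow> times_differentiable_on n g S"
  using assms(2)
proof (induction n arbitrary: f g)
  case 0
  then show ?case by (auto cong: continuous_on_cong)
next
  case (Suc n)
  \<comment> \<open>Both functions have the same candidates for a derivative at \<open>x\<close>, so
    the choice in \<open>frechet_derivative\<close> selects the same map, even where no derivative
    exists.\<close>
  have D: "(f has_derivative D) (at x) \<longleftrightarrow> (g has_derivative D) (at x)" if "x \<in> S" for x D
    using Suc.prems that assms(1) by (metis has_derivative_transform_within_open)
  then have fd: "frechet_derivative f (at x) = frechet_derivative g (at x)" if "x \<in> S" for x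
    using that by (simp add: frechet_derivative_def)
  have "times_differentiable_on n (\<lambda>x. frechet_derivative f (at x) v) S \<longleftrightarrow>
        times_differentiable_on n (\<lambda>x. frechet_derivative g (at x) v) S" for v
    by (rule Suc.IH) (simp add: fd)
  then show ?case using D by (auto simp: differentiable_def)
qed

text \<open>Uniqueness of the derivative identifies the chosen \<open>frechet_derivative\<close>
  with the formula \<open>f'\<close> on \<open>S\<close>, so the remaining orders can be checked on
  that formula.\<close>

lemma times_differentiable_on_SucI:
  assumes "open S" "\<And>x. x \<in> S \<Longrightarrow> (f has_derivative f' x) (at x)"
    and "\<And>v. times_differentiable_on n (\<lambda>x. f' x v) S"
  shows "times_differentiable_on (Suc n) f S"
proof -
  have "times_differentiable_on n (\<lambda>x. frechet_derivative f (at x) v) S" for v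
    using times_differentiable_on_cong[OF assms(1)] assms(2,3) frechet_derivative_at
    by (smt (verit))
  then show ?thesis using assms(2) by (auto simp: differentiable_def)
qed

lemma times_differentiable_on_SucD:
  assumes "times_differentiable_on (Suc n) f S"
  shows "x \<in> S \<Longrightarrow> (f has_derivative frechet_derivative f (at x)) (at x)"
    and "times_differentiable_on n (\<lambda>x. frechet_derivative f (at x) v) S"
  using assms by (auto simp: frechet_derivative_works)

text \<open>The Leibniz rule and the rules for \<open>inverse\<close>, \<open>ln\<close> and
  \<open>exp\<close> leave some factors undifferentiated; in an induction step these must be brought
  down to order \<open>n\<close>. The base case is that differentiability implies
  continuity.\<close>

lemma times_differentiable_on_lower:
  "times_differentiable_on (Suc n) f S \<Longrightarrow> times_differentiable_on n f S"
proof (induction n arbitrary: f)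
  case 0
  then show ?case
    by (auto intro!: continuous_at_imp_continuous_on differentiable_imp_continuous_within)
next
  case (Suc n)
  then show ?case by (metis times_differentiable_on.simps(2))
qed

section \<open>Closure of n-fold differentiability under algebraic and elementary operations\<close>

lemma times_differentiable_on_const:
  "open S \<Longrightarrow> times_differentiable_on n (\<lambda>x. c) S"
proof (induction n arbitrary: c)
  case (Suc n)
  then show ?case
    by (intro times_differentiable_on_SucI[where f' = "\<lambda>x h. 0"]) auto
qed simp

text \<open>Such a map is its own derivative at every point, so its directional derivatives are
  constant. It is applied to the coordinate projections \<open>fst\<close> and
  \<open>snd\<close>.\<close>

lemma times_differentiable_on_bounded_linear:
  assumes "open S" "bounded_linear f"
  shows "times_differentiable_on n f S"
proof (cases n)
  case 0
  then show ?thesis using assms by (simp add: linear_continuous_on)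
next
  case (Suc m)
  then show ?thesis
    using assms
    by (auto intro!: times_differentiable_on_SucI[where f' = "\<lambda>x. f"] bounded_linear_imp_has_derivative
        times_differentiable_on_const simp del: times_differentiable_on.simps)
qed

lemma times_differentiable_on_add:
  assumes "open S" "times_differentiable_on n f S" "times_differentiable_on n g S"
  shows "times_differentiable_on n (\<lambda>x. f x + g x) S"
  using assms(2,3)
proof (induction n arbitrary: f g)
  case 0
  then show ?case by (auto intro: continuous_intros)
next
  case (Suc n)
  note f = times_differentiable_on_SucD[OF Suc.prems(1)]
    and g = times_differentiable_on_SucD[OF Suc.prems(2)]
  show ?case
    by (rule times_differentiable_on_SucI[OF assms(1) has_derivative_add[OF f(1) g(1)]])
      (auto intro: Suc.IH f(2) g(2))
qed

lemma times_differentiable_on_mult: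
  fixes f g :: "'a::euclidean_space \<Rightarrow> real"
  assumes "open S" "times_differentiable_on n f S" "times_differentiable_on n g S"
  shows "times_differentiable_on n (\<lambda>x. f x * g x) S"
  using assms(2,3)
proof (induction n arbitrary: f g)
  case 0
  then show ?case by (auto intro: continuous_intros)
next
  case (Suc n)
  note f = times_differentiable_on_SucD[OF Suc.prems(1)]
    and g = times_differentiable_on_SucD[OF Suc.prems(2)]
  show ?case
    by (rule times_differentiable_on_SucI[OF assms(1) has_derivative_mult[OF f(1) g(1)]])
      (assumption | rule times_differentiable_on_add assms(1) Suc.IH f(2) g(2)
        Suc.prems[THEN times_differentiable_on_lower])+
qed

lemma times_differentiable_on_Pair:
  assumes "open S" "times_differentiable_on n f S" "times_differentiable_on n g S"
  shows "times_differentiable_on n (\<lambda>x. (f x, g x)) S"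
  using assms(2,3)
proof (induction n arbitrary: f g)
  case 0
  then show ?case by (auto intro: continuous_intros)
next
  case (Suc n)
  note f = times_differentiable_on_SucD[OF Suc.prems(1)]
    and g = times_differentiable_on_SucD[OF Suc.prems(2)]
  show ?case
    by (rule times_differentiable_on_SucI[OF assms(1) has_derivative_Pair[OF f(1) g(1)]])
      (auto intro: Suc.IH f(2) g(2))
qed

lemma times_differentiable_on_inverse:
  fixes f :: "'a::euclidean_space \<Rightarrow> real"
  assumes "open S" "times_differentiable_on n f S" "\<And>x. x \<in> S \<Longrightarrow> f x \<noteq> 0"
  shows "times_differentiable_on n (\<lambda>x. inverse (f x)) S"
  using assms(2)
proof (induction n)
  case 0
  then show ?case using assms(3) by (auto intro: continuous_intros)
next
  case (Suc n)
  note f = times_differentiable_on_SucD[OF Suc.prems]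
  have I: "times_differentiable_on n (\<lambda>x. inverse (f x)) S"
    by (rule Suc.IH[OF times_differentiable_on_lower[OF Suc.prems]])
  show ?case
  proof (rule times_differentiable_on_SucI[OF assms(1)])
    \<comment> \<open>The derivative involves only \<open>inverse (f x)\<close> itself and the
      derivative of \<open>f\<close>, both of order \<open>n\<close>. The sign and the square are
      spelled out as products so that the closure rules for constants and products apply.\<close>
    show "((\<lambda>x. inverse (f x)) has_derivative
        (\<lambda>h. - 1 * (inverse (f x) * inverse (f x) * frechet_derivative f (at x) h))) (at x)"
      if "x \<in> S" for x
      by (rule has_derivative_eq_rhs[OF Deriv.has_derivative_inverse[OF assms(3) f(1)]]) (use that in auto)
  qed (intro times_differentiable_on_mult times_differentiable_on_const assms(1) f(2) I)
qed

text \<open>One differentiation removes the logarithm, leaving \<open>inverse (f x)\<close> times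
  the derivative of \<open>f\<close>, so a case distinction replaces induction.\<close>

lemma times_differentiable_on_ln:
  fixes f :: "'a::euclidean_space \<Rightarrow> real"
  assumes "open S" "times_differentiable_on n f S" "\<And>x. x \<in> S \<Longrightarrow> f x > 0"
  shows "times_differentiable_on n (\<lambda>x. ln (f x)) S"
proof (cases n)
  case 0
  then show ?thesis using assms(2,3) by (force intro!: continuous_intros)
next
  case (Suc m)
  note f = times_differentiable_on_SucD[OF assms(2)[unfolded Suc]]
  have I: "times_differentiable_on m (\<lambda>x. inverse (f x)) S"
    using assms(3) times_differentiable_on_lower[OF assms(2)[unfolded Suc]]
    by (force intro: times_differentiable_on_inverse[OF assms(1)])
  have "times_differentiable_on (Suc m) (\<lambda>x. ln (f x)) S"
  proof (rule times_differentiable_on_SucI[OF assms(1)])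
    show "((\<lambda>x. ln (f x)) has_derivative
        (\<lambda>h. inverse (f x) * frechet_derivative f (at x) h)) (at x)"
      if "x \<in> S" for x
      by (rule has_derivative_eq_rhs[OF has_derivative_ln[OF assms(3) f(1)]])
        (use that in \<open>auto simp: field_simps\<close>)
  qed (intro times_differentiable_on_mult assms(1) f(2) I)
  then show ?thesis by (simp only: Suc)
qed

lemma times_differentiable_on_exp:
  fixes f :: "'a::euclidean_space \<Rightarrow> real"
  assumes "open S" "times_differentiable_on n f S"
  shows "times_differentiable_on n (\<lambda>x. exp (f x)) S"
  using assms(2)
proof (induction n)
  case 0
  then show ?case by (auto intro: continuous_intros)
next
  case (Suc n)
  note f = times_differentiable_on_SucD[OF Suc.prems]
  have I: "times_differentiable_on n (\<lambda>x. exp (f x)) S"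
    by (rule Suc.IH[OF times_differentiable_on_lower[OF Suc.prems]])
  show ?case
  proof (rule times_differentiable_on_SucI[OF assms(1)])
    show "((\<lambda>x. exp (f x)) has_derivative
        (\<lambda>h. exp (f x) * frechet_derivative f (at x) h)) (at x)"
      if "x \<in> S" for x
      by (rule has_derivative_eq_rhs[OF has_derivative_exp[OF f(1)]]) (use that in auto)
  qed (intro times_differentiable_on_mult assms(1) f(2) I)
qed

lemma smooth_on_cong:
  "open S \<Longrightarrow> (\<And>x. x \<in> S \<Longrightarrow> f x = g x) \<Longrightarrow> smooth_on f S \<longleftrightarrow> smooth_on g S"
  unfolding smooth_on_def using times_differentiable_on_cong by blast

section \<open>The Fisher--Rao metric of the Pareto family\<close>

lemma has_derivative_ln_pareto_density:
  assumes "0 < \<alpha>" "0 < \<beta>" "\<alpha> < x"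
  shows "((\<lambda>s. ln ((\<lambda>(\<alpha>, \<beta>). pareto_density \<alpha> \<beta>) s x)) has_derivative
          (\<lambda>u. fst u * \<beta> / \<alpha> + snd u * (1 / \<beta> - ln (x / \<alpha>)))) (at (\<alpha>, \<beta>))"
proof (rule has_derivative_transform_within_open)
  \<comment> \<open>Keeping the first parameter below \<open>x\<close> keeps \<open>x\<close> in the
    support, so a single formula for the log-density holds on a whole neighbourhood. At
    \<open>x = \<alpha>\<close> no such neighbourhood exists.\<close>
  show "open ({0<..<x} \<times> {0::real<..})" by (intro open_Times) auto
  show "(\<alpha>, \<beta>) \<in> {0<..<x} \<times> {0<..}" using assms by auto
  show "((\<lambda>s. ln (snd s) + snd s * ln (fst s) - (snd s + 1) * ln x) has_derivative
      (\<lambda>u. fst u * \<beta> / \<alpha> + snd u * (1 / \<beta> - ln (x / \<alpha>)))) (at (\<alpha>, \<beta>))"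
    using assms
    by (auto intro!: derivative_eq_intros ext simp: ln_div field_simps)
  show "ln (snd s) + snd s * ln (fst s) - (snd s + 1) * ln x =
      ln ((\<lambda>(\<alpha>, \<beta>). pareto_density \<alpha> \<beta>) s x)" if "s \<in> {0<..<x} \<times> {0<..}" for s
    using that by (auto simp: pareto_density_def ln_div ln_mult ln_powr)
qed

text \<open>As \<open>ln (x / \<alpha>)\<close> has derivative \<open>1 / x\<close>, this form
  exhibits it as an exponential variable of rate \<beta> and makes antiderivatives visible.\<close>

lemma pareto_density_eq_exp:
  assumes "0 < \<alpha>" "\<alpha> \<le> x"
  shows "pareto_density \<alpha> \<beta> x = \<beta> / x * exp (- \<beta> * ln (x / \<alpha>))"
  using assms
  by (simp add: pareto_density_def powr_def ln_div exp_add exp_diff exp_minus algebra_simps field_simps)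

lemma pareto_density_nonneg: "0 < \<beta> \<Longrightarrow> 0 \<le> pareto_density \<alpha> \<beta> x"
  by (simp add: pareto_density_def)

lemma borel_measurable_pareto_density [measurable]: "pareto_density \<alpha> \<beta> \<in> borel_measurable borel"
  unfolding pareto_density_def[abs_def] by measurable

text \<open>Nonnegative coefficients make the integrand nonnegative, so the fundamental theorem for
  nonnegative integrals on a half-line yields integrability and the value together.\<close>

lemma has_bochner_integral_pareto_density_quadratic_nonneg:
  assumes "0 < \<alpha>" "0 < \<beta>" and c: "0 \<le> c0" "0 \<le> c1" "0 \<le> c2"
  shows "has_bochner_integral lborel
    (\<lambda>x. pareto_density \<alpha> \<beta> x * (c0 + c1 * ln (x / \<alpha>) + c2 * ln (x / \<alpha>) ^ 2))
    (c0 + c1 / \<beta> + 2 * c2 / \<beta>\<^sup>2)"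
proof -
  \<comment> \<open>\<open>d0\<close> and \<open>d1\<close> come from comparing coefficients of \<open>ln (x / \<alpha>)\<close> in \<open>G' = f'\<close>.\<close>
  define d1 where "d1 = c1 + 2 * c2 / \<beta>"
  define d0 where "d0 = c0 + d1 / \<beta>"
  \<comment> \<open>An antiderivative is sought as the exponential times a quadratic in
    \<open>ln (x / \<alpha>)\<close>. It tends to 0 at infinity, and at \<alpha> the logarithm
    vanishes, so the integral is \<open>- G \<alpha> = d0\<close>.\<close>
  define G where "G x = - exp (- \<beta> * ln (x / \<alpha>)) * (d0 + d1 * ln (x / \<alpha>) + c2 * ln (x / \<alpha>) ^ 2)" for x
  define f where "f x = pareto_density \<alpha> \<beta> x * (c0 + c1 * ln (x / \<alpha>) + c2 * ln (x / \<alpha>) ^ 2)" for x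
  \<comment> \<open>The integrand without the case distinction in the density: it agrees with
    \<open>f\<close> from \<alpha> on, while \<open>f\<close> is 0 below \<alpha>, which accounts
    for the indicator.\<close>
  define f' where "f' x = \<beta> / x * exp (- \<beta> * ln (x / \<alpha>)) * (c0 + c1 * ln (x / \<alpha>) + c2 * ln (x / \<alpha>) ^ 2)" for x
  have f'_eq: "f' x = f x" if "\<alpha> \<le> x" for x
    using that assms by (simp add: f_def f'_def pareto_density_eq_exp)
  have L: "0 \<le> ln (x / \<alpha>)" if "\<alpha> \<le> x" for x
    using that assms by simp
  have f_nonneg: "0 \<le> f x" for x
  proof (cases "\<alpha> \<le> x")
    case True
    then show ?thesis
      using L[OF True] c assms unfolding f_def
      by (intro mult_nonneg_nonneg add_nonneg_nonneg pareto_density_nonneg) auto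
  qed (simp add: f_def pareto_density_def)
  have "(\<integral>\<^sup>+x. ennreal (f' x) * indicator {\<alpha> ..} x \<partial>lborel) = 0 - G \<alpha>"
  proof (rule nn_integral_FTC_atLeast)
    show "f' \<in> borel_measurable borel"
      unfolding f'_def by measurable
    show "DERIV G x :> f' x" if "\<alpha> \<le> x" for x
    proof -
      have "x > 0" using that assms by simp
      have "((\<lambda>x. ln (x / \<alpha>)) has_real_derivative 1 / x) (at x)"
        using \<open>x > 0\<close> assms by (auto intro!: derivative_eq_intros)
      note [derivative_intros] = this
      show ?thesis
        unfolding G_def f'_def d0_def d1_def
        by (rule derivative_eq_intros refl)+
          (use \<open>x > 0\<close> assms in \<open>simp add: field_simps power2_eq_square\<close>)
    qed
    show "0 \<le> f' x" if "\<alpha> \<le> x" for x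
      using f'_eq[OF that] f_nonneg[of x] by simp
    show "(G \<longlongrightarrow> 0) at_top"
      unfolding G_def using assms by real_asymp
  qed
  also have "(\<integral>\<^sup>+x. ennreal (f' x) * indicator {\<alpha> ..} x \<partial>lborel) = (\<integral>\<^sup>+x. ennreal (f x) \<partial>lborel)"
    by (rule nn_integral_cong) (auto simp: indicator_def f'_eq, simp add: f_def pareto_density_def)
  also have "0 - G \<alpha> = c0 + c1 / \<beta> + 2 * c2 / \<beta>\<^sup>2"
    using assms by (simp add: G_def d0_def d1_def field_simps power2_eq_square)
  finally show ?thesis
    using c assms(2) f_nonneg unfolding f_def
    by (intro has_bochner_integral_nn_integral) auto
qed

text \<open>Coefficients of arbitrary sign are reached by linearity from the moments of orders 0, 1
  and 2, each of which falls under the nonnegative case.\<close>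

lemma integral_pareto_density_quadratic:
  assumes "0 < \<alpha>" "0 < \<beta>"
  shows "(LINT x|lborel. pareto_density \<alpha> \<beta> x * (c0 + c1 * ln (x / \<alpha>) + c2 * ln (x / \<alpha>) ^ 2)) =
    c0 + c1 / \<beta> + 2 * c2 / \<beta>\<^sup>2"
proof -
  note m = has_bochner_integral_pareto_density_quadratic_nonneg[OF assms]
  have "has_bochner_integral lborel
      (\<lambda>x. c0 * pareto_density \<alpha> \<beta> x + c1 * (pareto_density \<alpha> \<beta> x * ln (x / \<alpha>)) +
        c2 * (pareto_density \<alpha> \<beta> x * ln (x / \<alpha>) ^ 2))
      (c0 * 1 + c1 * (1 / \<beta>) + c2 * (2 / \<beta>\<^sup>2))"
    using m[of 1 0 0] m[of 0 1 0] m[of 0 0 1]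
    by (intro has_bochner_integral_add has_bochner_integral_mult_right) simp_all
  from has_bochner_integral_integral_eq[OF this] show ?thesis
    by (simp add: algebra_simps)
qed

lemma fisher_rao_pareto_density:
  assumes "0 < \<alpha>" "0 < \<beta>"
  shows "fisher_rao (\<lambda>(\<alpha>, \<beta>). pareto_density \<alpha> \<beta>) (\<alpha>, \<beta>) u v =
    \<beta>\<^sup>2 / \<alpha>\<^sup>2 * (fst u * fst v) + 1 / \<beta>\<^sup>2 * (snd u * snd v)"
proof -
  define f where "f = (\<lambda>(\<alpha>, \<beta>). pareto_density \<alpha> \<beta>)"
  define D where "D x = frechet_derivative (\<lambda>s. ln (f s x)) (at (\<alpha>, \<beta>))" for x
  \<comment> \<open>\<open>A u\<close> is the part of the score in direction \<open>u\<close> that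
    does not depend on \<open>x\<close>; the rest is \<open>- snd u * ln (x / \<alpha>)\<close>. The
    product of two scores is thus a quadratic in the logarithm.\<close>
  define A where "A u = fst u * \<beta> / \<alpha> + snd u / \<beta>" for u :: "real \<times> real"
  define q where "q x = pareto_density \<alpha> \<beta> x * (A u * A v + (- A u * snd v - snd u * A v) * ln (x / \<alpha>)
      + (snd u * snd v) * ln (x / \<alpha>) ^ 2)" for x
  have D: "D x w = A w - snd w * ln (x / \<alpha>)" if "\<alpha> < x" for x w
    unfolding D_def f_def A_def
      frechet_derivative_at[OF has_derivative_ln_pareto_density[OF assms that], symmetric]
    by (simp add: algebra_simps)
  \<comment> \<open>The score formula serves only for \<open>\<alpha> < x\<close>; for
    \<open>x < \<alpha>\<close> both sides vanish with the density, whatever value \<open>D\<close>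
    has there.\<close>
  have eq: "D x u * D x v * f (\<alpha>, \<beta>) x = q x" if "x \<noteq> \<alpha>" for x
  proof (cases "\<alpha> < x")
    case True
    then show ?thesis
      by (simp add: D q_def f_def power2_eq_square algebra_simps)
  qed (use that in \<open>simp add: q_def f_def pareto_density_def\<close>)
  have "fisher_rao f (\<alpha>, \<beta>) u v = (LINT x|lborel. D x u * D x v * f (\<alpha>, \<beta>) x)"
    by (simp add: fisher_rao_def D_def)
  also have "\<dots> = (LINT x|lborel. q x)"
  proof (rule integral_cong_AE)
    have AE: "AE x in lborel. q x = D x u * D x v * f (\<alpha>, \<beta>) x"
      using AE_lborel_singleton[of \<alpha>] by eventually_elim (simp add: eq)
    then show "AE x in lborel. D x u * D x v * f (\<alpha>, \<beta>) x = q x"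
      by eventually_elim simp
    have q: "q \<in> borel_measurable lborel"
      unfolding q_def by measurable
    then show "q \<in> borel_measurable lborel" .
    \<comment> \<open>Measurability of \<open>D\<close> in \<open>x\<close> is not evident from its
      definition, but the integrand is the measurable \<open>q\<close> changed at one point.\<close>
    have "(\<lambda>x. D x u * D x v * f (\<alpha>, \<beta>) x) =
        (\<lambda>x. if x = \<alpha> then D \<alpha> u * D \<alpha> v * f (\<alpha>, \<beta>) \<alpha> else q x)"
      by (auto simp: eq)
    then show "(\<lambda>x. D x u * D x v * f (\<alpha>, \<beta>) x) \<in> borel_measurable lborel"
      using q by simp
  qed
  also have "\<dots> = A u * A v + (- A u * snd v - snd u * A v) / \<beta> + 2 * (snd u * snd v) / \<beta>\<^sup>2"
    unfolding q_def by (rule integral_pareto_density_quadratic[OF assms])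
  \<comment> \<open>Completing the product gives \<open>(A u - snd u / \<beta>) * (A v - snd v /
    \<beta>) + snd u * snd v / \<beta>\<^sup>2\<close>, and \<open>A u - snd u / \<beta>\<close> is
    \<open>fst u * \<beta> / \<alpha>\<close>; hence no mixed terms survive.\<close>
  also have "\<dots> = \<beta>\<^sup>2 / \<alpha>\<^sup>2 * (fst u * fst v) + 1 / \<beta>\<^sup>2 * (snd u * snd v)"
    using assms by (simp add: A_def field_simps power2_eq_square)
  finally show ?thesis by (simp add: f_def)
qed

section \<open>Points, charts and metrics of the two manifolds in coordinates\<close>

lemma points_pareto_manifold:
  "points pareto_manifold = (\<lambda>(\<alpha>, \<beta>). pareto_density \<alpha> \<beta>) ` ({0<..} \<times> {0<..})"
  by (auto simp: pareto_manifold_def)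

lemma pareto_density_in_points:
  "0 < \<alpha> \<Longrightarrow> 0 < \<beta> \<Longrightarrow> pareto_density \<alpha> \<beta> \<in> points pareto_manifold"
  by (auto simp: points_pareto_manifold)

lemma points_pareto_manifoldE:
  assumes "p \<in> points pareto_manifold"
  obtains \<alpha> \<beta> where "0 < \<alpha>" "0 < \<beta>" "p = pareto_density \<alpha> \<beta>"
  using assms by (auto simp: points_pareto_manifold)

lemma chart_pareto_manifold:
  "0 < \<alpha> \<Longrightarrow> 0 < \<beta> \<Longrightarrow> chart pareto_manifold (pareto_density \<alpha> \<beta>) = (\<alpha>, \<beta>)"
  by (simp add: pareto_manifold_def pareto_chart_density)

lemma metric_pareto_manifold:
  "0 < \<alpha> \<Longrightarrow> 0 < \<beta> \<Longrightarrow> metric pareto_manifold (pareto_density \<alpha> \<beta>) u v =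
    \<beta>\<^sup>2 / \<alpha>\<^sup>2 * (fst u * fst v) + 1 / \<beta>\<^sup>2 * (snd u * snd v)"
  by (simp add: pareto_manifold_def pareto_chart_density fisher_rao_pareto_density)

lemma inj_on_chart_pareto_manifold:
  "inj_on (chart pareto_manifold) (points pareto_manifold)"
  by (rule inj_onI) (auto elim!: points_pareto_manifoldE simp: chart_pareto_manifold)

lemma chart_image_pareto_manifold:
  "chart pareto_manifold ` points pareto_manifold = {0<..} \<times> {0<..}"
  by (force simp: points_pareto_manifold chart_pareto_manifold image_iff)

lemma inv_chart_pareto_manifold:
  assumes "0 < \<alpha>" "0 < \<beta>"
  shows "inv_into (points pareto_manifold) (chart pareto_manifold) (\<alpha>, \<beta>) = pareto_density \<alpha> \<beta>"
  using assms pareto_density_in_points inj_on_chart_pareto_manifold chart_pareto_manifold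
  by (metis inv_into_f_f)

lemma half_plane_simps [simp]:
  "points half_plane = UNIV \<times> {0<..}"
  "chart half_plane q = q"
  "chart half_plane ` S = S"
  "metric half_plane (x, y) u v = (fst u * fst v + snd u * snd v) / y\<^sup>2"
  by (auto simp: half_plane_def)

lemma inv_chart_half_plane:
  "0 < y \<Longrightarrow> inv_into (points half_plane) (chart half_plane) (x, y) = (x, y)"
  using inv_into_f_f[of "chart half_plane" "points half_plane" "(x, y)"]
  by (simp add: inj_on_def)

lemma open_quadrant: "open ({0<..} \<times> {0<..} :: (real \<times> real) set)"
  by (intro open_Times) auto

lemma open_half_plane: "open (UNIV \<times> {0<..} :: (real \<times> real) set)"
  by (intro open_Times) auto

section \<open>Riemannian structure: bilinearity, positivity and smooth coefficients\<close>

lemma riemannian_manifold_pareto_manifold: "riemannian_manifold pareto_manifold"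
  unfolding riemannian_manifold_def
proof (intro conjI ballI allI impI)
  show "inj_on (chart pareto_manifold) (points pareto_manifold)"
    by (rule inj_on_chart_pareto_manifold)
  show "open (chart pareto_manifold ` points pareto_manifold)"
    by (simp add: chart_image_pareto_manifold open_quadrant)
next
  fix p u v
  assume "p \<in> points pareto_manifold"
  then obtain \<alpha> \<beta> where p: "0 < \<alpha>" "0 < \<beta>" "p = pareto_density \<alpha> \<beta>"
    by (rule points_pareto_manifoldE)
  show "bilinear (metric pareto_manifold p)"
    using p by (auto simp: bilinear_def metric_pareto_manifold algebra_simps add_divide_distrib intro!: linearI)
  show "metric pareto_manifold p u v = metric pareto_manifold p v u"
    using p by (simp add: metric_pareto_manifold mult.commute)
  show "0 < metric pareto_manifold p u u" if "u \<noteq> 0"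
  proof -
    have "0 < (\<beta> / \<alpha> * fst u)\<^sup>2 + (snd u / \<beta>)\<^sup>2"
      using that p by (auto simp: sum_power2_gt_zero_iff prod_eq_iff)
    then show ?thesis
      using p by (simp add: metric_pareto_manifold power2_eq_square mult_ac)
  qed
next
  fix u v :: "real \<times> real"
  let ?S = "{0<..} \<times> {0<..} :: (real \<times> real) set"
  \<comment> \<open>The metric coefficients are rewritten with products and inverses only, to fit
    the closure rules; \<open>smooth_on_cong\<close> then carries smoothness back to the
    metric.\<close>
  have "times_differentiable_on n (\<lambda>c. (snd c * snd c) * (inverse (fst c) * inverse (fst c)) * (fst u * fst v)
      + (inverse (snd c) * inverse (snd c)) * (snd u * snd v)) ?S" for n
    by (intro times_differentiable_on_add times_differentiable_on_mult times_differentiable_on_const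
        times_differentiable_on_inverse times_differentiable_on_bounded_linear
        open_quadrant bounded_linear_fst bounded_linear_snd) auto
  then have "smooth_on (\<lambda>c. (snd c * snd c) * (inverse (fst c) * inverse (fst c)) * (fst u * fst v)
      + (inverse (snd c) * inverse (snd c)) * (snd u * snd v)) ?S"
    by (simp add: smooth_on_def)
  then show "smooth_on (\<lambda>c. metric pareto_manifold
      (inv_into (points pareto_manifold) (chart pareto_manifold) c) u v)
      (chart pareto_manifold ` points pareto_manifold)"
    unfolding chart_image_pareto_manifold
    by (rule smooth_on_cong[OF open_quadrant, THEN iffD1, rotated])
      (auto simp: inv_chart_pareto_manifold metric_pareto_manifold field_simps power2_eq_square)
qed

lemma riemannian_manifold_half_plane: "riemannian_manifold half_plane"
  unfolding riemannian_manifold_def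
proof (intro conjI ballI allI impI)
  show "inj_on (chart half_plane) (points half_plane)"
    by (simp add: inj_on_def)
  show "open (chart half_plane ` points half_plane)"
    by (simp add: open_half_plane)
next
  fix p u v
  assume "p \<in> points half_plane"
  then obtain x y where p: "p = (x, y)" "0 < y"
    by auto
  show "bilinear (metric half_plane p)"
    using p by (auto simp: bilinear_def algebra_simps add_divide_distrib intro!: linearI)
  show "metric half_plane p u v = metric half_plane p v u"
    using p by (simp add: mult.commute)
  show "0 < metric half_plane p u u" if "u \<noteq> 0"
  proof -
    have "0 < (fst u)\<^sup>2 + (snd u)\<^sup>2"
      using that by (auto simp: sum_power2_gt_zero_iff prod_eq_iff)
    then show ?thesis
      using p by (simp add: power2_eq_square)
  qed
next
  fix u v :: "real \<times> real"
  let ?S = "UNIV \<times> {0<..} :: (real \<times> real) set"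
  have "times_differentiable_on n
      (\<lambda>c. (fst u * fst v + snd u * snd v) * (inverse (snd c) * inverse (snd c))) ?S" for n
    by (intro times_differentiable_on_mult times_differentiable_on_const
        times_differentiable_on_inverse times_differentiable_on_bounded_linear
        open_half_plane bounded_linear_snd) auto
  then have "smooth_on
      (\<lambda>c. (fst u * fst v + snd u * snd v) * (inverse (snd c) * inverse (snd c))) ?S"
    by (simp add: smooth_on_def)
  then show "smooth_on (\<lambda>c. metric half_plane
      (inv_into (points half_plane) (chart half_plane) c) u v)
      (chart half_plane ` points half_plane)"
    unfolding half_plane_simps(1,3)
    by (rule smooth_on_cong[OF open_half_plane, THEN iffD1, rotated])
      (auto simp: inv_chart_half_plane[simplified] field_simps power2_eq_square)
qed

section \<open>The isometry\<close>

text \<open>\<open>F\<close> is prescribed only on the Pareto densities, since a total function also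
  has values elsewhere. Those values cannot matter: bijectivity is taken on the points, and
  smoothness and differentials on the open image of the chart.\<close>

theorem proposition12:
  fixes F :: "(real \<Rightarrow> real) \<Rightarrow> real \<times> real"
  assumes F: "\<And>\<alpha> \<beta>. \<alpha> > 0 \<Longrightarrow> \<beta> > 0 \<Longrightarrow> F (pareto_density \<alpha> \<beta>) = (ln \<alpha>, 1 / \<beta>)"
  shows "(\<forall>\<alpha>>0. \<forall>\<beta>>0. \<forall>u v. metric pareto_manifold (pareto_density \<alpha> \<beta>) u v =
            \<beta>\<^sup>2 / \<alpha>\<^sup>2 * (fst u * fst v) + 1 / \<beta>\<^sup>2 * (snd u * snd v)) \<and>
         diffeomorphism pareto_manifold half_plane F \<and>
         isometry pareto_manifold half_plane F"
proof -
  let ?Q = "{0<..} \<times> {0<..} :: (real \<times> real) set"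
  let ?H = "UNIV \<times> {0<..} :: (real \<times> real) set"
  let ?G = "inv_into (points pareto_manifold) F"
  have inj: "inj_on F (points pareto_manifold)"
    by (rule inj_onI) (auto elim!: points_pareto_manifoldE simp: F)
  \<comment> \<open>Solving \<open>ln \<alpha> = x\<close> and \<open>1 / \<beta> = y\<close> gives
    the preimage, which serves for surjectivity and for the formula of the inverse.\<close>
  have F_exp: "F (pareto_density (exp x) (1 / y)) = (x, y)" if "0 < y" for x y
    using that by (simp add: F)
  have F_into: "F p \<in> points half_plane" if "p \<in> points pareto_manifold" for p
    using that by (auto elim!: points_pareto_manifoldE simp: F)
  have bij: "bij_betw F (points pareto_manifold) (points half_plane)"
    unfolding bij_betw_def
  proof (intro conjI inj equalityI subsetI)
    fix q assume "q \<in> points half_plane"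
    then obtain x y where "q = (x, y)" "0 < y" by auto
    then show "q \<in> F ` points pareto_manifold"
      using F_exp[of y x] pareto_density_in_points[of "exp x" "1 / y"] by force
  qed (use F_into in blast)
  have G: "?G (x, y) = pareto_density (exp x) (1 / y)" if "0 < y" for x y
    using that inv_into_f_f[OF inj pareto_density_in_points[of "exp x" "1 / y"]]
    by (simp add: F_exp)
  have rep_F: "coord_rep pareto_manifold half_plane F (\<alpha>, \<beta>) = (ln \<alpha>, inverse \<beta>)"
    if "0 < \<alpha>" "0 < \<beta>" for \<alpha> \<beta>
    using that by (simp add: coord_rep_def inv_chart_pareto_manifold F inverse_eq_divide)
  have rep_G: "coord_rep half_plane pareto_manifold ?G (x, y) = (exp x, inverse y)"
    if "0 < y" for x y
    using that inv_chart_half_plane[OF that, of x]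
    by (simp add: coord_rep_def G chart_pareto_manifold inverse_eq_divide)
  have "times_differentiable_on n (\<lambda>c. (ln (fst c), inverse (snd c))) ?Q" for n
    by (intro times_differentiable_on_Pair times_differentiable_on_ln times_differentiable_on_inverse
        times_differentiable_on_bounded_linear open_quadrant bounded_linear_fst bounded_linear_snd) auto
  then have "smooth_on (\<lambda>c. (ln (fst c), inverse (snd c))) ?Q"
    by (simp add: smooth_on_def)
  then have "smooth_on (coord_rep pareto_manifold half_plane F) ?Q"
    by (rule smooth_on_cong[OF open_quadrant, THEN iffD1, rotated]) (auto simp: rep_F)
  then have smooth_F: "smooth_map pareto_manifold half_plane F"
    using F_into unfolding smooth_map_def chart_image_pareto_manifold by blast
  have "times_differentiable_on n (\<lambda>c. (exp (fst c), inverse (snd c))) ?H" for n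
    by (intro times_differentiable_on_Pair times_differentiable_on_exp times_differentiable_on_inverse
        times_differentiable_on_bounded_linear open_half_plane bounded_linear_fst bounded_linear_snd) auto
  then have "smooth_on (\<lambda>c. (exp (fst c), inverse (snd c))) ?H"
    by (simp add: smooth_on_def)
  then have "smooth_on (coord_rep half_plane pareto_manifold ?G) ?H"
    by (rule smooth_on_cong[OF open_half_plane, THEN iffD1, rotated]) (auto simp: rep_G)
  moreover have "?G ` points half_plane \<subseteq> points pareto_manifold"
    by (auto simp: G pareto_density_in_points)
  ultimately have smooth_G: "smooth_map half_plane pareto_manifold ?G"
    unfolding smooth_map_def by simp
  have diffeo: "diffeomorphism pareto_manifold half_plane F"
    unfolding diffeomorphism_def using bij smooth_F smooth_G by blast
  have pullback: "pullback_metric pareto_manifold half_plane F p u v = metric pareto_manifold p u v"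
    if "p \<in> points pareto_manifold" for p u v
  proof -
    from that obtain \<alpha> \<beta> where p: "0 < \<alpha>" "0 < \<beta>" "p = pareto_density \<alpha> \<beta>"
      by (rule points_pareto_manifoldE)
    \<comment> \<open>The coordinate expression of \<open>F\<close> is explicit only on the
      quadrant; as that set is open, the derivative of the explicit formula is the one
      required.\<close>
    have "(coord_rep pareto_manifold half_plane F has_derivative
        (\<lambda>u. (fst u / \<alpha>, - snd u / \<beta>\<^sup>2))) (at (\<alpha>, \<beta>))"
    proof (rule has_derivative_transform_within_open)
      show "((\<lambda>c. (ln (fst c), inverse (snd c))) has_derivative
          (\<lambda>u. (fst u / \<alpha>, - snd u / \<beta>\<^sup>2))) (at (\<alpha>, \<beta>))"
        using p by (auto intro!: derivative_eq_intros ext simp: field_simps power2_eq_square)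
      show "(\<alpha>, \<beta>) \<in> ?Q" using p by simp
    qed (use open_quadrant in \<open>auto simp: rep_F\<close>)
    then have "differential pareto_manifold half_plane F p = (\<lambda>u. (fst u / \<alpha>, - snd u / \<beta>\<^sup>2))"
      using p by (simp add: differential_def chart_pareto_manifold frechet_derivative_at[symmetric])
    \<comment> \<open>At \<open>F p\<close> the second coordinate is \<open>1 / \<beta>\<close>, so
      the half-plane metric carries the factor \<open>\<beta>\<^sup>2\<close>. It turns
      \<open>1 / \<alpha>\<^sup>2\<close> into \<open>\<beta>\<^sup>2 / \<alpha>\<^sup>2\<close> and
      \<open>1 / \<beta>^4\<close> into \<open>1 / \<beta>\<^sup>2\<close>; the minus signs
      cancel.\<close>
    then show ?thesis
      using p by (simp add: pullback_metric_def F metric_pareto_manifold field_simps power2_eq_square)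
  qed
  show ?thesis
    unfolding isometry_def
    using metric_pareto_manifold diffeo pullback
      riemannian_manifold_pareto_manifold riemannian_manifold_half_plane by blast
qed

end
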